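(* Let $J$ be a set and let $(G_j)_{j\in J}$ be a family of metagroups. Then their direct product $G=\prod_{j\in J}G_j$ (with componentwise multiplication) is a metagroup and $$Z(G)=\prod_{j\in J}Z(G_j).$$
   Context: Let $G$ be a set with a single-valued binary operation $(a,b)\mapsto ab$. Consider the conditions: (i) for all $a,b\in G$ there is a unique $x\in G$ with $ax=b$; (ii) for all $a,b\in G$ there is a unique $y\in G$ with $ya=b$; (iii) there is $e\in G$ with $eg=ge=g$ for each $g\in G$. $G$ is a loop if (i)-(iii) hold. The center of $G$ is $Z(G)=Com(G)\cap N(G)$, where $Com(G)=\{a\in G:\ ab=ba\ \forall b\in G\}$ and $N(G)$ is the set of all $a\in G$ such that $(ab)c=a(bc)$, $(ba)c=b(ac)$ and $(bc)a=b(ca)$ for all $b,c\in G$. $G$ is a (nonassociative) metagroup if it is a loop and for all $a,b,c\in G$ one has $(ab)c=t(a,b,c)\,a(bc)$ with $t(a,b,c)=t_G(a,b,c)\in Z(G)$. *)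

theory Defs
  imports "HOL-Algebra.Product_Groups"
begin

text \<open>
  A set with a binary operation is given by the fields \<^const>\<open>carrier\<close> and \<^const>\<open>mult\<close> of a
  \<^typ>\<open>'a monoid\<close> record (no associativity is implied by the record type). The neutral element
  of a loop is asserted to exist, so the field \<^const>\<open>one\<close> plays no role in what follows.
\<close>

definition commutant :: "('a, 'm) monoid_scheme \<Rightarrow> 'a set"
  where "commutant G = {a \<in> carrier G. \<forall>b\<in>carrier G. a \<otimes>\<^bsub>G\<^esub> b = b \<otimes>\<^bsub>G\<^esub> a}"

definition nucleus :: "('a, 'm) monoid_scheme \<Rightarrow> 'a set"
  where "nucleus G = {a \<in> carrier G. \<forall>b\<in>carrier G. \<forall>c\<in>carrier G.
      (a \<otimes>\<^bsub>G\<^esub> b) \<otimes>\<^bsub>G\<^esub> c = a \<otimes>\<^bsub>G\<^esub> (b \<otimes>\<^bsub>G\<^esub> c) \<and>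
      (b \<otimes>\<^bsub>G\<^esub> a) \<otimes>\<^bsub>G\<^esub> c = b \<otimes>\<^bsub>G\<^esub> (a \<otimes>\<^bsub>G\<^esub> c) \<and>
      (b \<otimes>\<^bsub>G\<^esub> c) \<otimes>\<^bsub>G\<^esub> a = b \<otimes>\<^bsub>G\<^esub> (c \<otimes>\<^bsub>G\<^esub> a)}"

definition center :: "('a, 'm) monoid_scheme \<Rightarrow> 'a set"
  where "center G = commutant G \<inter> nucleus G"

locale loop =
  fixes G (structure)
  assumes m_closed: "\<lbrakk>a \<in> carrier G; b \<in> carrier G\<rbrakk> \<Longrightarrow> a \<otimes> b \<in> carrier G"
    and left_division:
      "\<lbrakk>a \<in> carrier G; b \<in> carrier G\<rbrakk> \<Longrightarrow> \<exists>!x. x \<in> carrier G \<and> a \<otimes> x = b"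
    and right_division:
      "\<lbrakk>a \<in> carrier G; b \<in> carrier G\<rbrakk> \<Longrightarrow> \<exists>!y. y \<in> carrier G \<and> y \<otimes> a = b"
    and neutral_exists: "\<exists>e\<in>carrier G. \<forall>g\<in>carrier G. e \<otimes> g = g \<and> g \<otimes> e = g"

locale metagroup = loop +
  assumes assoc_up_to_center:
    "\<exists>t. \<forall>a\<in>carrier G. \<forall>b\<in>carrier G. \<forall>c\<in>carrier G.
      t a b c \<in> center G \<and> (a \<otimes> b) \<otimes> c = t a b c \<otimes> (a \<otimes> (b \<otimes> c))"

end

theory Submission
  imports Defs
begin

text \<open>Multiplication in the product is computed coordinate by coordinate, and elements of the
  product are functions fixed to \<open>undefined\<close> outside \<open>J\<close>, so an equation
  between them is a family of equations indexed by \<open>J\<close>. Divisions, neutral elements and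
  associators can therefore be found in each factor separately and assembled into one function.

  The center needs an argument in one direction only: central coordinates clearly give a central
  element, but conversely an element x of a single factor has to be tested against a coordinate of
  a. It is placed in the product as \<open>a(j := x)\<close>, whose remaining coordinates are those
  of a itself; reading the product identity at j gives the identity in the factor. This yields
  \<open>commutant_product_group\<close> and \<open>nucleus_product_group\<close>, hence
  \<open>center_product_group\<close>. The last of these is what makes the assembled associator
  central in \<open>metagroup_product_group\<close>; the loop axioms come from
  \<open>loop_product_group\<close>.\<close>

lemma PiE_ex1:
  assumes "\<And>j. j \<in> J \<Longrightarrow> \<exists>!x. x \<in> A j \<and> P j x"
  shows "\<exists>!f. f \<in> (\<Pi>\<^sub>E j\<in>J. A j) \<and> (\<forall>j\<in>J. P j (f j))"
proof -
  \<comment> \<open>Unique existence in each factor makes \<open>THE\<close> meaningful. The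
    restriction to \<open>J\<close> makes \<open>f\<close> extensional, which is also why another
    solution, agreeing with it on \<open>J\<close>, must equal it.\<close>
  define f where "f = (\<lambda>j\<in>J. THE x. x \<in> A j \<and> P j x)"
  have f: "f j \<in> A j \<and> P j (f j)" if "j \<in> J" for j
    using theI'[OF assms[OF that]] that by (simp add: f_def)
  show ?thesis
  proof (rule ex1I[of _ f])
    show "f \<in> (\<Pi>\<^sub>E j\<in>J. A j) \<and> (\<forall>j\<in>J. P j (f j))"
      using f by (auto simp: f_def)
  next
    fix g assume g: "g \<in> (\<Pi>\<^sub>E j\<in>J. A j) \<and> (\<forall>j\<in>J. P j (g j))"
    show "g = f"
    proof (rule PiE_ext)
      show "g \<in> (\<Pi>\<^sub>E j\<in>J. A j)" "f \<in> (\<Pi>\<^sub>E j\<in>J. A j)"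
        using f g by (auto simp: f_def)
      show "g j = f j" if "j \<in> J" for j
        using assms[OF that] f[OF that] g that by (auto simp: PiE_mem)
    qed
  qed
qed

text \<open>Products in \<open>product_group\<close> are restrictions to \<open>J\<close>; this
  turns an equation whose other side is an element of the product into its coordinate
  equations.\<close>

lemma restrict_eq_iff:
  assumes "f \<in> extensional J"
  shows "restrict g J = f \<longleftrightarrow> (\<forall>j\<in>J. g j = f j)"
  using assms by (auto simp: fun_eq_iff extensional_def)

text \<open>Supplies the test elements for the commutant and the nucleus: \<open>f\<close> fills the
  coordinates other than \<open>i\<close>.\<close>

lemma PiE_fun_upd_mem:
  assumes "f \<in> (\<Pi>\<^sub>E j\<in>J. A j)" and "i \<in> J" and "x \<in> A i"
  shows "f(i := x) \<in> (\<Pi>\<^sub>E j\<in>J. A j)"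
  using assms by (auto simp: PiE_iff extensional_def)

lemma commutant_product_group:
  "commutant (product_group J G) = (\<Pi>\<^sub>E j\<in>J. commutant (G j))"
proof (intro equalityI subsetI)
  fix a assume comm: "a \<in> commutant (product_group J G)"
  then have a: "a \<in> (\<Pi>\<^sub>E j\<in>J. carrier (G j))"
    by (simp add: commutant_def)
  have "a j \<in> commutant (G j)" if j: "j \<in> J" for j
  proof -
    have "a j \<otimes>\<^bsub>G j\<^esub> x = x \<otimes>\<^bsub>G j\<^esub> a j" if "x \<in> carrier (G j)" for x
    proof -
      let ?P = "product_group J G" and ?b = "a(j := x)"
      have "?b \<in> carrier ?P"
        using PiE_fun_upd_mem[OF a j that] by simp
      with comm have "a \<otimes>\<^bsub>?P\<^esub> ?b = ?b \<otimes>\<^bsub>?P\<^esub> a"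
        unfolding commutant_def by blast
      \<comment> \<open>At coordinate j the test element \<open>?b\<close> has value x, so the two
        products there are those of \<open>a j\<close> and x.\<close>
      from fun_cong[OF this, of j] show ?thesis
        using j by simp
    qed
    then show ?thesis
      using a j by (auto simp: commutant_def PiE_mem)
  qed
  then show "a \<in> (\<Pi>\<^sub>E j\<in>J. commutant (G j))"
    using a by (simp add: PiE_iff)
next
  fix a assume "a \<in> (\<Pi>\<^sub>E j\<in>J. commutant (G j))"
  then show "a \<in> commutant (product_group J G)"
    \<comment> \<open>Both sides of the required identity are restrictions to \<open>J\<close>, so
      comparing them on \<open>J\<close> suffices.\<close>
    by (auto simp: commutant_def PiE_iff intro!: restrict_ext)
qed

lemma nucleus_product_group:
  "nucleus (product_group J G) = (\<Pi>\<^sub>E j\<in>J. nucleus (G j))"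
proof (intro equalityI subsetI)
  fix a assume nuc: "a \<in> nucleus (product_group J G)"
  then have a: "a \<in> (\<Pi>\<^sub>E j\<in>J. carrier (G j))"
    by (simp add: nucleus_def)
  have "a j \<in> nucleus (G j)" if j: "j \<in> J" for j
  proof -
    have "(a j \<otimes>\<^bsub>G j\<^esub> x) \<otimes>\<^bsub>G j\<^esub> y = a j \<otimes>\<^bsub>G j\<^esub> (x \<otimes>\<^bsub>G j\<^esub> y) \<and>
        (x \<otimes>\<^bsub>G j\<^esub> a j) \<otimes>\<^bsub>G j\<^esub> y = x \<otimes>\<^bsub>G j\<^esub> (a j \<otimes>\<^bsub>G j\<^esub> y) \<and>
        (x \<otimes>\<^bsub>G j\<^esub> y) \<otimes>\<^bsub>G j\<^esub> a j = x \<otimes>\<^bsub>G j\<^esub> (y \<otimes>\<^bsub>G j\<^esub> a j)"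
      if x: "x \<in> carrier (G j)" and y: "y \<in> carrier (G j)" for x y
    proof -
      \<comment> \<open>Two independent test elements are needed here, carrying x and y at
        coordinate j.\<close>
      let ?P = "product_group J G" and ?b = "a(j := x)" and ?c = "a(j := y)"
      have "?b \<in> carrier ?P" "?c \<in> carrier ?P"
        using PiE_fun_upd_mem[OF a j x] PiE_fun_upd_mem[OF a j y] by simp_all
      with nuc have
        "(a \<otimes>\<^bsub>?P\<^esub> ?b) \<otimes>\<^bsub>?P\<^esub> ?c = a \<otimes>\<^bsub>?P\<^esub> (?b \<otimes>\<^bsub>?P\<^esub> ?c)"
        "(?b \<otimes>\<^bsub>?P\<^esub> a) \<otimes>\<^bsub>?P\<^esub> ?c = ?b \<otimes>\<^bsub>?P\<^esub> (a \<otimes>\<^bsub>?P\<^esub> ?c)"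
        "(?b \<otimes>\<^bsub>?P\<^esub> ?c) \<otimes>\<^bsub>?P\<^esub> a = ?b \<otimes>\<^bsub>?P\<^esub> (?c \<otimes>\<^bsub>?P\<^esub> a)"
        unfolding nucleus_def by blast+
      from this[THEN fun_cong, of j] show ?thesis
        using j by simp
    qed
    then show ?thesis
      using a j by (auto simp: nucleus_def PiE_mem)
  qed
  then show "a \<in> (\<Pi>\<^sub>E j\<in>J. nucleus (G j))"
    using a by (simp add: PiE_iff)
next
  fix a assume "a \<in> (\<Pi>\<^sub>E j\<in>J. nucleus (G j))"
  then show "a \<in> nucleus (product_group J G)"
    by (auto simp: nucleus_def PiE_iff intro!: restrict_ext)
qed

lemma center_product_group:
  "center (product_group J G) = (\<Pi>\<^sub>E j\<in>J. center (G j))"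
  by (auto simp: center_def commutant_product_group nucleus_product_group PiE_iff)

lemma loop_product_group:
  assumes "\<And>j. j \<in> J \<Longrightarrow> loop (G j)"
  shows "loop (product_group J G)"
proof
  fix a b
  assume a: "a \<in> carrier (product_group J G)" and b: "b \<in> carrier (product_group J G)"
  show "a \<otimes>\<^bsub>product_group J G\<^esub> b \<in> carrier (product_group J G)"
    using a b assms by (auto simp: PiE_iff intro: loop.m_closed)
  \<comment> \<open>Division in the product is a simultaneous division in every factor, and
    \<open>PiE_ex1\<close> collects the unique quotients.\<close>
  have "\<exists>!x. x \<in> (\<Pi>\<^sub>E j\<in>J. carrier (G j)) \<and> (\<forall>j\<in>J. a j \<otimes>\<^bsub>G j\<^esub> x j = b j)"
    using a b assms by (intro PiE_ex1 loop.left_division) (auto simp: PiE_iff)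
  then show "\<exists>!x. x \<in> carrier (product_group J G) \<and> a \<otimes>\<^bsub>product_group J G\<^esub> x = b"
    using b by (simp add: restrict_eq_iff PiE_iff)
  have "\<exists>!y. y \<in> (\<Pi>\<^sub>E j\<in>J. carrier (G j)) \<and> (\<forall>j\<in>J. y j \<otimes>\<^bsub>G j\<^esub> a j = b j)"
    using a b assms by (intro PiE_ex1 loop.right_division) (auto simp: PiE_iff)
  then show "\<exists>!y. y \<in> carrier (product_group J G) \<and> y \<otimes>\<^bsub>product_group J G\<^esub> a = b"
    using b by (simp add: restrict_eq_iff PiE_iff)
next
  have "\<forall>j\<in>J. \<exists>e. e \<in> carrier (G j) \<and> (\<forall>g\<in>carrier (G j). e \<otimes>\<^bsub>G j\<^esub> g = g \<and> g \<otimes>\<^bsub>G j\<^esub> e = g)"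
    using loop.neutral_exists[OF assms] by blast
  then obtain e where e: "\<forall>j\<in>J. e j \<in> carrier (G j) \<and>
      (\<forall>g\<in>carrier (G j). e j \<otimes>\<^bsub>G j\<^esub> g = g \<and> g \<otimes>\<^bsub>G j\<^esub> e j = g)"
    by (auto dest: bchoice)
  \<comment> \<open>The choice function \<open>e\<close> is arbitrary outside \<open>J\<close>;
    restricting it gives an element of the product.\<close>
  have "restrict e J \<in> carrier (product_group J G)"
    using e by simp
  moreover have "restrict e J \<otimes>\<^bsub>product_group J G\<^esub> g = g \<and> g \<otimes>\<^bsub>product_group J G\<^esub> restrict e J = g"
    if "g \<in> carrier (product_group J G)" for g
    using that e by (simp add: restrict_eq_iff PiE_iff)
  ultimately show "\<exists>e\<in>carrier (product_group J G). \<forall>g\<in>carrier (product_group J G).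
      e \<otimes>\<^bsub>product_group J G\<^esub> g = g \<and> g \<otimes>\<^bsub>product_group J G\<^esub> e = g"
    by blast
qed

lemma metagroup_product_group:
  assumes "\<And>j. j \<in> J \<Longrightarrow> metagroup (G j)"
  shows "metagroup (product_group J G)"
proof -
  let ?P = "product_group J G"
  have "\<forall>j\<in>J. \<exists>t. \<forall>a\<in>carrier (G j). \<forall>b\<in>carrier (G j). \<forall>c\<in>carrier (G j).
      t a b c \<in> center (G j) \<and>
      (a \<otimes>\<^bsub>G j\<^esub> b) \<otimes>\<^bsub>G j\<^esub> c = t a b c \<otimes>\<^bsub>G j\<^esub> (a \<otimes>\<^bsub>G j\<^esub> (b \<otimes>\<^bsub>G j\<^esub> c))"
    by (intro ballI metagroup.assoc_up_to_center assms)
  from bchoice[OF this] obtain t where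
    t: "\<forall>j\<in>J. \<forall>a\<in>carrier (G j). \<forall>b\<in>carrier (G j). \<forall>c\<in>carrier (G j).
      t j a b c \<in> center (G j) \<and>
      (a \<otimes>\<^bsub>G j\<^esub> b) \<otimes>\<^bsub>G j\<^esub> c = t j a b c \<otimes>\<^bsub>G j\<^esub> (a \<otimes>\<^bsub>G j\<^esub> (b \<otimes>\<^bsub>G j\<^esub> c))" ..
  \<comment> \<open>The associator of the product consists of the chosen associators of the factors,
    again cut down to \<open>J\<close>.\<close>
  define s where "s a b c = (\<lambda>j\<in>J. t j (a j) (b j) (c j))" for a b c
  have "s a b c \<in> center ?P \<and>
      (a \<otimes>\<^bsub>?P\<^esub> b) \<otimes>\<^bsub>?P\<^esub> c = s a b c \<otimes>\<^bsub>?P\<^esub> (a \<otimes>\<^bsub>?P\<^esub> (b \<otimes>\<^bsub>?P\<^esub> c))"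
    if "a \<in> carrier ?P" "b \<in> carrier ?P" "c \<in> carrier ?P" for a b c
  proof
    have t': "t j (a j) (b j) (c j) \<in> center (G j)"
      "(a j \<otimes>\<^bsub>G j\<^esub> b j) \<otimes>\<^bsub>G j\<^esub> c j =
        t j (a j) (b j) (c j) \<otimes>\<^bsub>G j\<^esub> (a j \<otimes>\<^bsub>G j\<^esub> (b j \<otimes>\<^bsub>G j\<^esub> c j))"
      if j: "j \<in> J" for j
    proof -
      have "a j \<in> carrier (G j)" "b j \<in> carrier (G j)" "c j \<in> carrier (G j)"
        using \<open>a \<in> carrier ?P\<close> \<open>b \<in> carrier ?P\<close> \<open>c \<in> carrier ?P\<close> j
        by (simp_all add: PiE_iff)
      from t[rule_format, OF j this]
      show "t j (a j) (b j) (c j) \<in> center (G j)"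
        "(a j \<otimes>\<^bsub>G j\<^esub> b j) \<otimes>\<^bsub>G j\<^esub> c j =
          t j (a j) (b j) (c j) \<otimes>\<^bsub>G j\<^esub> (a j \<otimes>\<^bsub>G j\<^esub> (b j \<otimes>\<^bsub>G j\<^esub> c j))"
        by simp_all
    qed
    \<comment> \<open>Since the center of the product is the product of the centers, centrality can
      be checked in each coordinate.\<close>
    show "s a b c \<in> center ?P"
      using t'(1) by (simp add: s_def center_product_group)
    show "(a \<otimes>\<^bsub>?P\<^esub> b) \<otimes>\<^bsub>?P\<^esub> c = s a b c \<otimes>\<^bsub>?P\<^esub> (a \<otimes>\<^bsub>?P\<^esub> (b \<otimes>\<^bsub>?P\<^esub> c))"
      by (auto simp: s_def t'(2) intro!: restrict_ext)
  qed
  then have "metagroup_axioms ?P"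
    by (intro metagroup_axioms.intro exI[of _ s] ballI)
  with loop_product_group[OF metagroup.axioms(1)[OF assms]] show ?thesis
    by (rule metagroup.intro)
qed

theorem theorem3p1:
  fixes J :: "'j set" and G :: "'j \<Rightarrow> ('a, 'm) monoid_scheme"
  assumes "\<And>j. j \<in> J \<Longrightarrow> metagroup (G j)"
  shows "metagroup (product_group J G) \<and>
    center (product_group J G) = (\<Pi>\<^sub>E j\<in>J. center (G j))"
  by (rule conjI[OF metagroup_product_group[OF assms] center_product_group])

end
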